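(* For every integer $r\geq 2$, the set $$\{s\in\mathbb N : s\equiv 1\pmod 4,\ \ell(s)=r\}$$ is the union of exactly $F_{r-1}$ residue classes modulo $2^{r+2}$.
   Context: $\mathbb N$ denotes the positive integers. The Collatz function $T:\mathbb N\to\mathbb N$ is $T(n)=n/2$ if $n$ is even and $T(n)=(3n+1)/2$ if $n$ is odd; $T^0(s)=s$ and $T^k(s)=T(T^{k-1}(s))$ for $k\geq1$. For odd $s\in\mathbb N$, the cut time is $$\ell(s)=\min\{k\geq1 : T^k(s)\equiv 3\pmod 4 \text{ and } T^{k-1}(s)\text{ is even}\},$$ with $\ell(s)=\infty$ if this set is empty. A residue class modulo $m$ means a set $[a]_m=\{n\in\mathbb N: n\equiv a\pmod m\}$. The Fibonacci numbers are $F_0=0$, $F_1=1$, $F_{m+1}=F_m+F_{m-1}$ for $m\geq1$. *)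

theory Defs
  imports "HOL-Number_Theory.Number_Theory" "HOL-Library.Extended_Nat"
begin

(* The set of positive integers is modelled as the positive elements of nat;
   collatz maps positive numbers to positive numbers (and 0 to 0). *)

definition collatz :: "nat \<Rightarrow> nat" where
  "collatz n = (if even n then n div 2 else (3 * n + 1) div 2)"

definition is_cut :: "nat \<Rightarrow> nat \<Rightarrow> bool" where
  "is_cut s k \<longleftrightarrow>
     k \<ge> 1 \<and> [(collatz ^^ k) s = 3] (mod 4) \<and> even ((collatz ^^ (k - 1)) s)"

(* Only the values at odd positive s are meaningful. *)
definition cut_time :: "nat \<Rightarrow> enat" where
  "cut_time s = (if \<exists>k. is_cut s k then enat (LEAST k. is_cut s k) else \<infinity>)"

definition residue_class :: "nat \<Rightarrow> nat \<Rightarrow> nat set" where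
  "residue_class m a = {n. n > 0 \<and> [n = a] (mod m)}"

end

(* The parities of the first n iterates of s determine, and are determined by, s modulo 2 ^ n, and
   every binary word of length n occurs. A number s = 1 (mod 4) has cut time r iff its parity word
   of length r + 2 is 1 followed by a word that starts with 0 and contains 011 at its end and
   nowhere else. After the initial 0 such a word continues either with another 0, or with 1 and
   then 0, which gives the Fibonacci recurrence. *)
theory Submission
  imports Defs
begin

fun parity_word :: "nat \<Rightarrow> nat \<Rightarrow> bool list" where
  "parity_word 0 s = []"
| "parity_word (Suc n) s = odd s # parity_word n (collatz s)"

lemma length_parity_word [simp]: "length (parity_word n s) = n"
  by (induction n arbitrary: s) auto

lemma collatz_cong_iff:
  assumes "even a \<longleftrightarrow> even b"
  shows "[collatz a = collatz b] (mod 2 ^ n) \<longleftrightarrow> [a = b] (mod 2 ^ Suc n)"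
proof -
  have double: "[x = y] (mod 2 ^ n) \<longleftrightarrow> [2 * x = 2 * y] (mod 2 ^ Suc n)" for x y :: nat
    by (simp add: cong_def mult_mod_right [symmetric])
  show ?thesis
  proof (cases "even a")
    case True
    then show ?thesis
      using assms double by (simp add: collatz_def)
  next
    case False
    have "[collatz a = collatz b] (mod 2 ^ n) \<longleftrightarrow> [3 * a + 1 = 3 * b + 1] (mod 2 ^ Suc n)"
      using assms False double by (simp add: collatz_def)
    also have "\<dots> \<longleftrightarrow> [3 * a = 3 * b] (mod 2 ^ Suc n)"
      by (rule cong_add_rcancel_nat)
    also have "\<dots> \<longleftrightarrow> [a = b] (mod 2 ^ Suc n)"
    proof (rule cong_mult_lcancel_nat)
      have "coprime (3::nat) 2"
        by (simp add: coprime_iff_gcd_eq_1 gcd_non_0_nat)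
      then show "coprime (3::nat) (2 ^ Suc n)"
        by (rule coprime_power_right_iff [THEN iffD2, OF disjI1])
    qed
    finally show ?thesis .
  qed
qed

lemma parity_word_eq_iff: "parity_word n a = parity_word n b \<longleftrightarrow> [a = b] (mod 2 ^ n)"
proof (induction n arbitrary: a b)
  case (Suc n)
  have "even a \<longleftrightarrow> even b" if "[a = b] (mod 2 ^ Suc n)"
    by (rule cong_dvd_iff [OF cong_dvd_modulus_nat [OF that]]) simp
  then show ?case
    using Suc collatz_cong_iff [of a b n] by auto
qed simp

lemma bij_betw_parity_word: "bij_betw (parity_word n) {..<2 ^ n} {w. length w = n}"
proof -
  have inj: "inj_on (parity_word n) {..<2 ^ n}"
    by (auto simp: inj_on_def parity_word_eq_iff cong_def)
  have "card {w :: bool list. length w = n} = 2 ^ n"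
    using card_lists_length_eq [of "UNIV :: bool set" n] by simp
  moreover have "finite {w :: bool list. length w = n}"
    using finite_lists_length_eq [of "UNIV :: bool set" n] by simp
  ultimately have "parity_word n ` {..<2 ^ n} = {w. length w = n}"
    by (intro card_subset_eq) (auto simp: card_image [OF inj])
  with inj show ?thesis
    by (simp add: bij_betw_def)
qed

(* Every residue class is nonempty, since n > 0 is only required of its elements, not of the
   representative. *)
lemma inj_on_residue_class: "inj_on (residue_class m) {..<m}"
proof (rule inj_onI)
  fix a b
  assume "a \<in> {..<m}" and "b \<in> {..<m}" and eq: "residue_class m a = residue_class m b"
  then have less: "a < m" "b < m"
    by auto
  then have "a + m \<in> residue_class m a"
    by (simp add: residue_class_def cong_def)
  then have "a + m \<in> residue_class m b"
    by (simp only: eq)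
  with less show "a = b"
    by (simp add: residue_class_def cong_def)
qed

lemma parity_word_residue_classes:
  assumes W: "\<And>w. w \<in> W \<Longrightarrow> length w = n"
  shows "\<exists>C. C \<subseteq> range (residue_class (2 ^ n)) \<and> finite C \<and> card C = card W \<and>
           {s. s > 0 \<and> parity_word n s \<in> W} = \<Union> C"
proof -
  define A where "A = {a. a < 2 ^ n \<and> parity_word n a \<in> W}"
  have A: "A \<subseteq> {..<2 ^ n}"
    by (auto simp: A_def)
  have "parity_word n ` A = W"
  proof (intro equalityI subsetI)
    fix w
    assume "w \<in> W"
    then have "w \<in> parity_word n ` {..<2 ^ n}"
      using W by (simp add: bij_betw_imp_surj_on [OF bij_betw_parity_word])
    with \<open>w \<in> W\<close> show "w \<in> parity_word n ` A"
      by (auto simp: A_def)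
  qed (auto simp: A_def)
  then have "card W = card A"
    using card_image [OF inj_on_subset [OF bij_betw_imp_inj_on [OF bij_betw_parity_word] A]] by simp
  also have "\<dots> = card (residue_class (2 ^ n) ` A)"
    using inj_on_subset [OF inj_on_residue_class A] by (simp add: card_image)
  finally have "card (residue_class (2 ^ n) ` A) = card W" ..
  moreover have "{s. s > 0 \<and> parity_word n s \<in> W} = \<Union> (residue_class (2 ^ n) ` A)"
  proof (intro equalityI subsetI)
    fix s
    assume "s \<in> {s. s > 0 \<and> parity_word n s \<in> W}"
    moreover have "parity_word n (s mod 2 ^ n) = parity_word n s"
      by (simp add: parity_word_eq_iff)
    ultimately have "s \<in> residue_class (2 ^ n) (s mod 2 ^ n)" "s mod 2 ^ n \<in> A"
      by (auto simp: residue_class_def A_def cong_def)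
    then show "s \<in> \<Union> (residue_class (2 ^ n) ` A)"
      by blast
  next
    fix s
    assume "s \<in> \<Union> (residue_class (2 ^ n) ` A)"
    then show "s \<in> {s. s > 0 \<and> parity_word n s \<in> W}"
      by (auto simp: residue_class_def A_def simp flip: parity_word_eq_iff)
  qed
  moreover have "finite A"
    using A finite_subset by blast
  ultimately show ?thesis
    by (intro exI [of _ "residue_class (2 ^ n) ` A"] conjI)
       (simp_all only: finite_imageI image_mono subset_UNIV)
qed

(* The words that start with 0 and contain 011 at position m, at their end, and nowhere else. *)
fun cut_words :: "nat \<Rightarrow> bool list set" where
  "cut_words 0 = {[False, True, True]}"
| "cut_words (Suc 0) = {[False, False, True, True]}"
| "cut_words (Suc (Suc m)) =
     (#) False ` cut_words (Suc m) \<union> (\<lambda>w. False # True # w) ` cut_words m"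

lemma finite_cut_words [simp]: "finite (cut_words m)"
  by (induction m rule: cut_words.induct) auto

lemma length_cut_words: "w \<in> cut_words m \<Longrightarrow> length w = Suc (Suc (Suc m))"
  by (induction m arbitrary: w rule: cut_words.induct) auto

lemma hd_cut_words: "w \<in> cut_words m \<Longrightarrow> \<not> hd w"
  by (induction m arbitrary: w rule: cut_words.induct) auto

lemma card_cut_words: "card (cut_words m) = fib (Suc m)"
proof (induction m rule: cut_words.induct)
  case (3 m)
  have "(#) False ` cut_words (Suc m) \<inter> (\<lambda>w. False # True # w) ` cut_words m = {}"
    using hd_cut_words by fastforce
  then have "card (cut_words (Suc (Suc m))) = card (cut_words (Suc m)) + card (cut_words m)"
    by (simp add: card_Un_disjoint card_image inj_on_def)
  with 3 show ?case
    by simp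
qed simp_all

lemma cong_3_mod_4_iff: "[n = 3] (mod 4) \<longleftrightarrow> odd n \<and> odd (collatz n)"
  unfolding cong_def collatz_def by (auto; presburger)

lemma cong_1_mod_4_iff: "[n = 1] (mod 4) \<longleftrightarrow> odd n \<and> even (collatz n)"
  unfolding cong_def collatz_def by (auto; presburger)

lemma not_is_cut_0 [simp]: "\<not> is_cut s 0"
  by (simp add: is_cut_def)

lemma is_cut_1 [simp]:
  "is_cut s (Suc 0) \<longleftrightarrow> even s \<and> odd (collatz s) \<and> odd (collatz (collatz s))"
  by (auto simp: is_cut_def cong_3_mod_4_iff)

lemma is_cut_Suc_Suc [simp]: "is_cut s (Suc (Suc k)) \<longleftrightarrow> is_cut (collatz s) (Suc k)"
  by (simp add: is_cut_def funpow_Suc_right del: funpow.simps)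

definition first_cut :: "nat \<Rightarrow> nat \<Rightarrow> bool" where
  "first_cut s k \<longleftrightarrow> is_cut s k \<and> (\<forall>j<k. \<not> is_cut s j)"

lemma cut_time_eq_iff: "cut_time s = enat k \<longleftrightarrow> first_cut s k"
  unfolding cut_time_def first_cut_def
  by (auto dest: not_less_Least intro: LeastI intro!: Least_equality simp: not_less [symmetric])

lemma first_cut_1: "first_cut s (Suc 0) \<longleftrightarrow> is_cut s (Suc 0)"
  by (simp add: first_cut_def)

lemma first_cut_Suc_Suc:
  "first_cut s (Suc (Suc k)) \<longleftrightarrow> \<not> is_cut s (Suc 0) \<and> first_cut (collatz s) (Suc k)"
  by (auto simp: first_cut_def All_less_Suc2 simp del: is_cut_1)

lemma first_cut_iff_parity_word:
  "even t \<Longrightarrow> first_cut t (Suc m) \<longleftrightarrow> parity_word (Suc (Suc (Suc m))) t \<in> cut_words m"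
proof (induction m arbitrary: t rule: cut_words.induct)
  case 1
  then show ?case
    by (simp add: first_cut_1)
next
  case 2
  then show ?case
    by (auto simp: first_cut_Suc_Suc first_cut_1)
next
  case (3 m)
  let ?w = "parity_word (Suc (Suc (Suc m))) (collatz (collatz t))"
  show ?case
  proof (cases "even (collatz t)")
    case True
    then have "first_cut t (Suc (Suc (Suc m))) \<longleftrightarrow> first_cut (collatz t) (Suc (Suc m))"
      by (simp add: first_cut_Suc_Suc [of t])
    also have "\<dots> \<longleftrightarrow> False # ?w \<in> cut_words (Suc m)"
      using "3.IH"(1) [OF True] True by simp
    also have "\<dots> \<longleftrightarrow> False # False # ?w \<in> cut_words (Suc (Suc m))"
      by auto
    finally show ?thesis
      using True \<open>even t\<close> by simp
  next
    case False
    have "first_cut t (Suc (Suc (Suc m))) \<longleftrightarrow>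
        even (collatz (collatz t)) \<and> first_cut (collatz (collatz t)) (Suc m)"
      using False \<open>even t\<close>
      by (simp add: first_cut_Suc_Suc [of t] first_cut_Suc_Suc [of "collatz t"])
    also have "\<dots> \<longleftrightarrow> ?w \<in> cut_words m"
      using "3.IH"(2) [of "collatz (collatz t)"] hd_cut_words [of ?w m] by auto
    also have "\<dots> \<longleftrightarrow> False # True # ?w \<in> cut_words (Suc (Suc m))"
      using hd_cut_words [of "True # ?w" "Suc m"] by auto
    finally show ?thesis
      using False \<open>even t\<close> by simp
  qed
qed

theorem theorem1p1:
  fixes r :: nat
  assumes "r \<ge> 2"
  shows "\<exists>C :: nat set set.
           C \<subseteq> range (residue_class (2 ^ (r + 2))) \<and>
           finite C \<and> card C = fib (r - 1) \<and>
           {s :: nat. s > 0 \<and> [s = 1] (mod 4) \<and> cut_time s = enat r} = \<Union> C"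
proof -
  obtain m where r: "r = Suc (Suc m)"
    using assms by (metis add_2_eq_Suc le_Suc_ex)
  define W where "W = (#) True ` cut_words m"
  have card: "card W = fib (r - 1)"
    by (simp add: W_def r card_image card_cut_words)
  have length: "length w = r + 2" if "w \<in> W" for w
    using that length_cut_words by (auto simp: W_def r)
  have "[s = 1] (mod 4) \<and> cut_time s = enat r \<longleftrightarrow> parity_word (r + 2) s \<in> W" for s
  proof -
    let ?w = "parity_word (Suc (Suc (Suc m))) (collatz s)"
    have "[s = 1] (mod 4) \<and> cut_time s = enat r \<longleftrightarrow>
        odd s \<and> even (collatz s) \<and> first_cut (collatz s) (Suc m)"
      unfolding cong_1_mod_4_iff by (auto simp: r cut_time_eq_iff first_cut_Suc_Suc)
    also have "\<dots> \<longleftrightarrow> odd s \<and> ?w \<in> cut_words m"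
      using first_cut_iff_parity_word [of "collatz s" m] hd_cut_words [of ?w m] by auto
    also have "\<dots> \<longleftrightarrow> odd s # ?w \<in> W"
      unfolding W_def by blast
    finally show ?thesis
      by (simp add: r)
  qed
  then have "{s. s > 0 \<and> [s = 1] (mod 4) \<and> cut_time s = enat r} =
      {s. s > 0 \<and> parity_word (r + 2) s \<in> W}"
    by simp
  then show ?thesis
    using parity_word_residue_classes [of W "r + 2", OF length] by (simp only: card)
qed

end
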